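(* Let $n\ge 2$ and $\beta\in(1/2,1]$. There exist positive constants $B$ and $b$ such that for every $f\in BMO^\beta(\mathbb{R}^n)\cap L^2(\mathbb{R}^n)$ with $\|f\|_{BMO^\beta(\mathbb{R}^n)}\ne 0$ the following hold. (i) For all $0<t\le\|f\|_{BMO^\beta(\mathbb{R}^n)}$, $$|\{x\in\mathbb{R}^n:|f(x)|>t\}|\le\frac{B\|f\|_{L^2(\mathbb{R}^n)}^2}{t^2}\exp\left(\frac{-bt}{\|f\|_{BMO^\beta(\mathbb{R}^n)}}\right).$$ (ii) For all $t>\|f\|_{BMO^\beta(\mathbb{R}^n)}$, $$|\{x\in\mathbb{R}^n:|f(x)|>t\}|\le\frac{B\|f\|_{L^2(\mathbb{R}^n)}^2}{\|f\|_{BMO^\beta(\mathbb{R}^n)}^2}.$$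
   Context: All cubes in $\mathbb{R}^n$ have edges parallel to the coordinate axes; $l(I)$ denotes the edge length of a cube $I$ and $|E|$ the Lebesgue measure of a set $E$. For $\alpha\in(-\infty,\beta)$ and $\beta\in(1/2,1]$, $Q_\alpha^\beta(\mathbb{R}^n)$ is the set of all measurable complex-valued functions $f$ on $\mathbb{R}^n$ with $$\|f\|_{Q_\alpha^\beta(\mathbb{R}^n)}=\sup_I\left((l(I))^{2(\alpha+\beta-1)-n}\int_I\int_I\frac{|f(x)-f(y)|^2}{|x-y|^{n+2(\alpha-\beta+1)}}\,dx\,dy\right)^{1/2}<\infty,$$ the supremum being over all cubes $I$ in $\mathbb{R}^n$. The space $BMO^\beta(\mathbb{R}^n)$ is defined as $Q^\beta_{-\frac n2+\beta-1}(\mathbb{R}^n)$, with the corresponding norm; up to a constant factor, $\|f\|_{BMO^\beta(\mathbb{R}^n)}^2$ equals $\sup_I\frac{(l(I))^{4\beta-4}}{|I|}\int_I|f(x)-f(I)|^2\,dx$, where $f(I)=\frac1{|I|}\int_I f(x)\,dx$. *)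

theory Defs
  imports "HOL-Analysis.Analysis"
begin

definition cube :: "real ^ 'n \<Rightarrow> real \<Rightarrow> (real ^ 'n) set" where
  "cube a l = cbox a (\<chi> i. a $ i + l)"

definition ennsqrt :: "ennreal \<Rightarrow> ennreal" where
  "ennsqrt z = (if z = \<infinity> then \<infinity> else ennreal (sqrt (enn2real z)))"

text \<open>On the diagonal, which is a null set, the quotient is 0 by the convention
  \<open>0 / 0 = 0\<close>. The supremum is \<open>\<infinity>\<close> unless the quantities are uniformly bounded over all cubes.\<close>

definition Q_enorm :: "real \<Rightarrow> real \<Rightarrow> (real ^ 'n \<Rightarrow> complex) \<Rightarrow> ennreal" where
  "Q_enorm \<alpha> \<beta> f =
    (SUP (a, l) \<in> UNIV \<times> {0<..}.
      ennsqrt (ennreal (l powr (2 * (\<alpha> + \<beta> - 1) - real CARD('n))) *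
        (\<integral>\<^sup>+ y \<in> cube a l. (\<integral>\<^sup>+ x \<in> cube a l.
            ennreal ((cmod (f x - f y))\<^sup>2 /
              dist x y powr (real CARD('n) + 2 * (\<alpha> - \<beta> + 1)))
          \<partial>lebesgue) \<partial>lebesgue)))"

definition Q_space :: "real \<Rightarrow> real \<Rightarrow> (real ^ 'n \<Rightarrow> complex) set" where
  "Q_space \<alpha> \<beta> = {f \<in> borel_measurable lebesgue. Q_enorm \<alpha> \<beta> f < \<infinity>}"

definition Q_norm :: "real \<Rightarrow> real \<Rightarrow> (real ^ 'n \<Rightarrow> complex) \<Rightarrow> real" where
  "Q_norm \<alpha> \<beta> f = enn2real (Q_enorm \<alpha> \<beta> f)"

definition BMO_space :: "real \<Rightarrow> (real ^ 'n \<Rightarrow> complex) set" where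
  "BMO_space \<beta> = Q_space (- real CARD('n) / 2 + \<beta> - 1) \<beta>"

definition BMO_norm :: "real \<Rightarrow> (real ^ 'n \<Rightarrow> complex) \<Rightarrow> real" where
  "BMO_norm \<beta> (f :: real ^ 'n \<Rightarrow> complex) = Q_norm (- real CARD('n) / 2 + \<beta> - 1) \<beta> f"

definition L2_space :: "(real ^ 'n \<Rightarrow> complex) set" where
  "L2_space = {f \<in> borel_measurable lebesgue. integrable lebesgue (\<lambda>x. (cmod (f x))\<^sup>2)}"

definition L2_norm :: "(real ^ 'n \<Rightarrow> complex) \<Rightarrow> real" where
  "L2_norm f = sqrt (LINT x|lebesgue. (cmod (f x))\<^sup>2)"

end

theory Submission
  imports Defs
begin

text \<open>
  In both ranges of \<open>t\<close> the bound is Chebyshev's inequality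
  \<open>|{|f| > t}| \<le> \<parallel>f\<parallel>\<^sub>2\<^sup>2 / t\<^sup>2\<close>: for \<open>t\<close> up to the BMO norm the exponential
  factor is at least \<open>exp (- b)\<close>, which the constant \<open>B = exp b\<close> absorbs (here \<open>b = 1\<close>), and
  beyond the norm \<open>1 / t\<^sup>2\<close> only decreases.
\<close>

text \<open>Markov's inequality for the integrable function \<open>?g\<close> at level
  \<open>t\<^sup>2\<close>. Squaring is monotone on nonnegative reals, so the strict superlevel set
  of the modulus lies in the closed one of \<open>?g\<close>.\<close>

lemma L2_Chebyshev:
  assumes f: "f \<in> L2_space" and t: "t > 0"
  shows "emeasure lebesgue {x. cmod (f x) > t} \<le> ennreal ((L2_norm f)\<^sup>2 / t\<^sup>2)"
proof -
  let ?g = "\<lambda>x. (cmod (f x))\<^sup>2"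
  have int: "integrable lebesgue ?g"
    using f by (simp add: L2_space_def)
  \<comment> \<open>Monotonicity of \<open>emeasure\<close> asks for measurability of the larger
    set.\<close>
  have meas: "{x. ?g x \<ge> t\<^sup>2} \<in> sets lebesgue"
    using borel_measurable_le[OF borel_measurable_const borel_measurable_integrable[OF int]] by simp
  have "emeasure lebesgue {x. cmod (f x) > t} \<le> emeasure lebesgue {x. ?g x \<ge> t\<^sup>2}"
    using meas t by (intro emeasure_mono) (auto intro: power_mono)
  also have "\<dots> \<le> ennreal ((LINT x|lebesgue. ?g x) / t\<^sup>2)"
    using integral_Markov_inequality[OF int, of "t\<^sup>2"] t by simp
  also have "(LINT x|lebesgue. ?g x) = (L2_norm f)\<^sup>2"
    by (simp add: L2_norm_def)
  finally show ?thesis .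
qed

theorem proposition1p4:
  fixes \<beta> :: real
  assumes "CARD('n::finite) \<ge> 2"
    and "1/2 < \<beta>" and "\<beta> \<le> 1"
  shows "\<exists>B b :: real. B > 0 \<and> b > 0 \<and>
    (\<forall>f :: real ^ 'n \<Rightarrow> complex.
      f \<in> BMO_space \<beta> \<inter> L2_space \<longrightarrow> BMO_norm \<beta> f \<noteq> 0 \<longrightarrow>
        (\<forall>t. 0 < t \<and> t \<le> BMO_norm \<beta> f \<longrightarrow>
          emeasure lebesgue {x. cmod (f x) > t} \<le>
            ennreal (B * (L2_norm f)\<^sup>2 / t\<^sup>2 * exp (- b * t / BMO_norm \<beta> f))) \<and>
        (\<forall>t. t > BMO_norm \<beta> f \<longrightarrow>
          emeasure lebesgue {x. cmod (f x) > t} \<le>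
            ennreal (B * (L2_norm f)\<^sup>2 / (BMO_norm \<beta> f)\<^sup>2)))"
proof (rule exI[of _ "exp 1"], rule exI[of _ 1], intro conjI allI impI)
  fix f :: "real ^ 'n \<Rightarrow> complex" and t :: real
  assume f: "f \<in> BMO_space \<beta> \<inter> L2_space" and "BMO_norm \<beta> f \<noteq> 0"
  \<comment> \<open>Values of \<open>enn2real\<close> are nonnegative, so nonzero means
    positive.\<close>
  then have N: "BMO_norm \<beta> f > 0"
    by (simp add: BMO_norm_def Q_norm_def less_le)
  {
    assume t: "0 < t \<and> t \<le> BMO_norm \<beta> f"
    \<comment> \<open>The 1 in the exponent is the factor \<open>exp 1\<close> chosen for
      \<open>B\<close>; the exponent is nonnegative exactly because \<open>t\<close> is at most the
      norm.\<close>
    have "1 \<le> exp (1 - t / BMO_norm \<beta> f)"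
      using t N by simp
    then have "(L2_norm f)\<^sup>2 / t\<^sup>2 * 1 \<le> (L2_norm f)\<^sup>2 / t\<^sup>2 * exp (1 - t / BMO_norm \<beta> f)"
      by (intro mult_left_mono) simp_all
    also have "\<dots> = exp 1 * (L2_norm f)\<^sup>2 / t\<^sup>2 * exp (- 1 * t / BMO_norm \<beta> f)"
      by (simp add: exp_diff exp_minus field_simps)
    finally show "emeasure lebesgue {x. cmod (f x) > t} \<le>
        ennreal (exp 1 * (L2_norm f)\<^sup>2 / t\<^sup>2 * exp (- 1 * t / BMO_norm \<beta> f))"
      using L2_Chebyshev[of f t] f t by (auto intro: order_trans ennreal_leI)
  next
    assume t: "t > BMO_norm \<beta> f"
    have "(L2_norm f)\<^sup>2 / t\<^sup>2 \<le> 1 * (L2_norm f)\<^sup>2 / (BMO_norm \<beta> f)\<^sup>2"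
      using t N by (simp add: divide_left_mono power_mono)
    \<comment> \<open>The factor 1 would do in this range; it is enlarged so that one
      \<open>B\<close> serves both.\<close>
    also have "\<dots> \<le> exp 1 * (L2_norm f)\<^sup>2 / (BMO_norm \<beta> f)\<^sup>2"
      by (intro divide_right_mono mult_right_mono) simp_all
    finally show "emeasure lebesgue {x. cmod (f x) > t} \<le>
        ennreal (exp 1 * (L2_norm f)\<^sup>2 / (BMO_norm \<beta> f)\<^sup>2)"
      using L2_Chebyshev[of f t] f t N by (auto intro: order_trans ennreal_leI)
  }
qed simp_all

end
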